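(* There exists $x\in JH$ with $\|x\|=1$ such that $$\inf_{\alpha>0}\operatorname{diam}S(B_{JH^*},x,\alpha)=0.$$
   Context: All Banach spaces are real. For a Banach space $X$, $B_X$ is its closed unit ball and $X^*$ its topological dual; for $x\in X$, $\alpha>0$ and bounded $B\subseteq X^*$, the $w^*$-slice is $S(B,x,\alpha)=\{x^*\in B: x^*(x)>\sup_{y^*\in B}y^*(x)-\alpha\}$. The dyadic tree is $T=\{(n,i):0\le n<\infty,\ 0\le i<2^n\}$; the offspring of $(n,i)$ are $(n+1,2i)$ and $(n+1,2i+1)$. The $n$-th level of $T$ is $\{(n,i):0\le i<2^n\}$. A segment is a non-empty finite set $\{t_1,\ldots,t_k\}$ such that $t_{j+1}$ is an offspring of $t_j$ for $1\le j\le k-1$; it is an $n$-$m$ segment ($n\le m$) if its first element lies in level $n$ and its last in level $m$ (so it has exactly one element in each level between $n$ and $m$). A finite family $\{S_1,\ldots,S_k\}$ of segments is admissible if there are $p\le q$ such that every $S_i$ is a $p$-$q$ segment and $S_i\cap S_j=\emptyset$ for $i\ne j$. $JH$ is the completion of the space of finitely nonzero functions $x:T\to\mathbb R$ under the norm $\|x\|=\max\sum_{i=1}^k\left|\sum_{t\in S_i}x(t)\right|$, the maximum being over all admissible families $\{S_1,\ldots,S_k\}$ of segments of $T$. *)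

theory Defs
  imports "HOL-Analysis.Analysis"
begin

section \<open>Completion of a real normed space\<close>

text \<open>
  The completion is the usual space of Cauchy sequences modulo null sequences, with
  \<open>norm [X] = lim (norm \<circ> X)\<close>. The lemmas \<open>linear_embed_completion\<close>, \<open>norm_embed_completion\<close> and \<open>closure_range_embed_completion\<close>
  together with the class instance \<open>banach\<close> show that this is a completion.
\<close>

definition cauchy_equiv :: "(nat \<Rightarrow> 'a::real_normed_vector) \<Rightarrow> (nat \<Rightarrow> 'a) \<Rightarrow> bool" where
  "cauchy_equiv X Y \<longleftrightarrow> Cauchy X \<and> Cauchy Y \<and> (\<lambda>n. X n - Y n) \<longlonglongrightarrow> 0"

lemma Cauchy_add':
  fixes X Y :: "nat \<Rightarrow> 'a::real_normed_vector"
  assumes "Cauchy X" "Cauchy Y"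
  shows "Cauchy (\<lambda>n. X n + Y n)"
  unfolding Cauchy_iff
proof (intro allI impI)
  fix e :: real assume "e > 0"
  then have e: "e / 2 > 0" by simp
  obtain M where M: "\<And>m n. m \<ge> M \<Longrightarrow> n \<ge> M \<Longrightarrow> norm (X m - X n) < e / 2"
    using assms(1) e unfolding Cauchy_iff by meson
  obtain N where N: "\<And>m n. m \<ge> N \<Longrightarrow> n \<ge> N \<Longrightarrow> norm (Y m - Y n) < e / 2"
    using assms(2) e unfolding Cauchy_iff by meson
  have "norm (X m + Y m - (X n + Y n)) < e" if "m \<ge> max M N" "n \<ge> max M N" for m n
  proof -
    have "norm (X m + Y m - (X n + Y n)) \<le> norm (X m - X n) + norm (Y m - Y n)"
      by (metis add_diff_add norm_triangle_ineq)
    moreover have "norm (X m - X n) < e / 2" using M that by auto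
    moreover have "norm (Y m - Y n) < e / 2" using N that by auto
    ultimately show ?thesis by linarith
  qed
  then show "\<exists>M. \<forall>m\<ge>M. \<forall>n\<ge>M. norm (X m + Y m - (X n + Y n)) < e" by blast
qed

lemma Cauchy_scaleR': "Cauchy X \<Longrightarrow> Cauchy (\<lambda>n. a *\<^sub>R X n :: 'a::real_normed_vector)"
  by (rule bounded_linear.Cauchy[OF bounded_linear_scaleR_right])

lemma Cauchy_minus': "Cauchy X \<Longrightarrow> Cauchy (\<lambda>n. - X n :: 'a::real_normed_vector)"
  using Cauchy_scaleR'[of X "-1"] by simp

lemma Cauchy_diff':
  fixes X Y :: "nat \<Rightarrow> 'a::real_normed_vector"
  shows "Cauchy X \<Longrightarrow> Cauchy Y \<Longrightarrow> Cauchy (\<lambda>n. X n - Y n)"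
  using Cauchy_add'[of X "\<lambda>n. - Y n"] Cauchy_minus'[of Y] by simp

lemma Cauchy_const': "Cauchy (\<lambda>n. c :: 'a::real_normed_vector)"
  by (intro convergent_Cauchy convergent_const)

lemma convergent_norm_Cauchy:
  fixes X :: "nat \<Rightarrow> 'a::real_normed_vector"
  assumes "Cauchy X"
  shows "convergent (\<lambda>n. norm (X n))"
proof -
  have "Cauchy (\<lambda>n. norm (X n))"
    unfolding Cauchy_iff
  proof (intro allI impI)
    fix e :: real assume "e > 0"
    then obtain M where M: "\<And>m n. m \<ge> M \<Longrightarrow> n \<ge> M \<Longrightarrow> norm (X m - X n) < e"
      using assms unfolding Cauchy_iff by meson
    have "norm (norm (X m) - norm (X n)) < e" if "m \<ge> M" "n \<ge> M" for m n
      using M[OF that] norm_triangle_ineq3[of "X m" "X n"] by simp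
    then show "\<exists>M. \<forall>m\<ge>M. \<forall>n\<ge>M. norm (norm (X m) - norm (X n)) < e" by blast
  qed
  then show ?thesis by (rule Cauchy_convergent)
qed

lemma cauchy_equiv_sym: "cauchy_equiv X Y \<Longrightarrow> cauchy_equiv Y X"
  unfolding cauchy_equiv_def using tendsto_minus[of "\<lambda>n. X n - Y n" 0 sequentially] by simp

lemma cauchy_equiv_trans:
  assumes "cauchy_equiv X Y" "cauchy_equiv Y Z"
  shows "cauchy_equiv X Z"
  using assms tendsto_add[of "\<lambda>n. X n - Y n" 0 sequentially "\<lambda>n. Y n - Z n" 0]
  unfolding cauchy_equiv_def by simp

quotient_type (overloaded) 'a completion = "nat \<Rightarrow> 'a::real_normed_vector" / partial: cauchy_equiv
proof (rule part_equivpI)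
  show "\<exists>X :: nat \<Rightarrow> 'a. cauchy_equiv X X"
    by (rule exI[of _ "\<lambda>n. 0"]) (simp add: cauchy_equiv_def Cauchy_const')
  show "symp (cauchy_equiv :: (nat \<Rightarrow> 'a) \<Rightarrow> _)" by (rule sympI) (rule cauchy_equiv_sym)
  show "transp (cauchy_equiv :: (nat \<Rightarrow> 'a) \<Rightarrow> _)" by (rule transpI) (rule cauchy_equiv_trans)
qed

lift_definition embed_completion :: "'a::real_normed_vector \<Rightarrow> 'a completion" is "\<lambda>x n. x"
  by (simp add: cauchy_equiv_def Cauchy_const')

instantiation completion :: (real_normed_vector) real_normed_vector
begin

lift_definition zero_completion :: "'a completion" is "\<lambda>n. 0"
  by (simp add: cauchy_equiv_def Cauchy_const')

lift_definition plus_completion :: "'a completion \<Rightarrow> 'a completion \<Rightarrow> 'a completion"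
  is "\<lambda>X Y n. X n + Y n"
proof -
  fix X X' Y Y' :: "nat \<Rightarrow> 'a"
  assume *: "cauchy_equiv X X'" "cauchy_equiv Y Y'"
  then have "(\<lambda>n. (X n - X' n) + (Y n - Y' n)) \<longlonglongrightarrow> 0 + 0"
    unfolding cauchy_equiv_def by (intro tendsto_add) auto
  with * show "cauchy_equiv (\<lambda>n. X n + Y n) (\<lambda>n. X' n + Y' n)"
    unfolding cauchy_equiv_def by (simp add: Cauchy_add' add_diff_add)
qed

lift_definition scaleR_completion :: "real \<Rightarrow> 'a completion \<Rightarrow> 'a completion"
  is "\<lambda>a X n. a *\<^sub>R X n"
proof -
  fix a and X X' :: "nat \<Rightarrow> 'a"
  assume *: "cauchy_equiv X X'"
  then have "(\<lambda>n. a *\<^sub>R (X n - X' n)) \<longlonglongrightarrow> a *\<^sub>R 0"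
    unfolding cauchy_equiv_def by (intro tendsto_intros) auto
  with * show "cauchy_equiv (\<lambda>n. a *\<^sub>R X n) (\<lambda>n. a *\<^sub>R X' n)"
    unfolding cauchy_equiv_def by (simp add: Cauchy_scaleR' scaleR_diff_right)
qed

lift_definition norm_completion :: "'a completion \<Rightarrow> real" is "\<lambda>X. lim (\<lambda>n. norm (X n))"
proof -
  fix X X' :: "nat \<Rightarrow> 'a"
  assume *: "cauchy_equiv X X'"
  have a: "(\<lambda>n. norm (X' n)) \<longlonglongrightarrow> lim (\<lambda>n. norm (X' n))"
    using * convergent_norm_Cauchy unfolding cauchy_equiv_def convergent_LIMSEQ_iff by blast
  have "(\<lambda>n. norm (X n) - norm (X' n)) \<longlonglongrightarrow> 0"
  proof (rule Lim_null_comparison)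
    show "\<forall>\<^sub>F n in sequentially. norm (norm (X n) - norm (X' n)) \<le> norm (X n - X' n)"
      by (simp add: norm_triangle_ineq3)
    show "(\<lambda>n. norm (X n - X' n)) \<longlonglongrightarrow> 0"
      using * unfolding cauchy_equiv_def by (simp add: tendsto_norm_zero)
  qed
  from tendsto_add[OF this a] have "(\<lambda>n. norm (X n)) \<longlonglongrightarrow> lim (\<lambda>n. norm (X' n))" by simp
  then show "lim (\<lambda>n. norm (X n)) = lim (\<lambda>n. norm (X' n))" by (rule limI)
qed

lift_definition uminus_completion :: "'a completion \<Rightarrow> 'a completion" is "\<lambda>X n. - X n"
  using tendsto_minus by (fastforce simp: cauchy_equiv_def Cauchy_minus')

lift_definition minus_completion :: "'a completion \<Rightarrow> 'a completion \<Rightarrow> 'a completion"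
  is "\<lambda>X Y n. X n - Y n"
proof -
  fix X X' Y Y' :: "nat \<Rightarrow> 'a"
  assume *: "cauchy_equiv X X'" "cauchy_equiv Y Y'"
  then have "(\<lambda>n. (X n - X' n) - (Y n - Y' n)) \<longlonglongrightarrow> 0 - 0"
    unfolding cauchy_equiv_def by (intro tendsto_diff) auto
  with * show "cauchy_equiv (\<lambda>n. X n - Y n) (\<lambda>n. X' n - Y' n)"
    unfolding cauchy_equiv_def by (simp add: Cauchy_diff' algebra_simps)
qed

definition dist_completion :: "'a completion \<Rightarrow> 'a completion \<Rightarrow> real" where
  "dist_completion x y = norm (x - y)"

definition uniformity_completion :: "('a completion \<times> 'a completion) filter" where
  "uniformity_completion = (INF e\<in>{0 <..}. principal {(x, y). dist x y < e})"

definition open_completion :: "'a completion set \<Rightarrow> bool" where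
  "open_completion U \<longleftrightarrow> (\<forall>x\<in>U. \<forall>\<^sub>F (x', y) in uniformity. x' = x \<longrightarrow> y \<in> U)"

definition sgn_completion :: "'a completion \<Rightarrow> 'a completion" where
  "sgn_completion x = scaleR (inverse (norm x)) x"

lemma norm_completion_tendsto:
  "cauchy_equiv X X \<Longrightarrow> (\<lambda>n. norm (X n :: 'a)) \<longlonglongrightarrow> lim (\<lambda>n. norm (X n))"
  using convergent_norm_Cauchy unfolding cauchy_equiv_def convergent_LIMSEQ_iff by blast

instance
proof
  fix x y z :: "'a completion" and a b :: real
  have null: "cauchy_equiv X Y" if "cauchy_equiv X X" "\<And>n. X n = Y n" for X Y :: "nat \<Rightarrow> 'a"
  proof -
    have "X = Y" using that(2) by blast
    with that(1) show ?thesis by simp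
  qed
  show "x + y + z = x + (y + z)"
    by transfer (rule null, auto simp: cauchy_equiv_def Cauchy_add' add.assoc)
  show "x + y = y + x"
    by transfer (rule null, auto simp: cauchy_equiv_def Cauchy_add' add.commute)
  show "0 + x = x"
    by transfer (rule null, auto simp: cauchy_equiv_def)
  show "- x + x = 0"
    by transfer (auto simp: cauchy_equiv_def Cauchy_const')
  show "x - y = x + - y"
    by transfer (rule null, auto simp: cauchy_equiv_def Cauchy_diff')
  show "a *\<^sub>R (x + y) = a *\<^sub>R x + a *\<^sub>R y"
    by transfer (rule null, auto simp: cauchy_equiv_def Cauchy_add' Cauchy_scaleR' scaleR_add_right)
  show "(a + b) *\<^sub>R x = a *\<^sub>R x + b *\<^sub>R x"
    by transfer (rule null, auto simp: cauchy_equiv_def Cauchy_add' Cauchy_scaleR' scaleR_add_left)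
  show "a *\<^sub>R b *\<^sub>R x = (a * b) *\<^sub>R x"
    by transfer (rule null, auto simp: cauchy_equiv_def Cauchy_scaleR')
  show "1 *\<^sub>R x = x"
    by transfer (rule null, auto simp: cauchy_equiv_def)
  show "dist x y = norm (x - y)" by (rule dist_completion_def)
  show "sgn x = scaleR (inverse (norm x)) x" by (rule sgn_completion_def)
  show "uniformity = (INF e\<in>{0 <..}. principal {(x :: 'a completion, y). dist x y < e})"
    by (rule uniformity_completion_def)
  show "open U \<longleftrightarrow> (\<forall>x\<in>U. \<forall>\<^sub>F (x', y) in uniformity. x' = x \<longrightarrow> y \<in> U)"
    for U :: "'a completion set"
    by (rule open_completion_def)
  show "norm x = 0 \<longleftrightarrow> x = 0"
  proof (transfer, rule iffI)
    fix X :: "nat \<Rightarrow> 'a"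
    assume X: "cauchy_equiv X X" and "lim (\<lambda>n. norm (X n)) = 0"
    then have "(\<lambda>n. norm (X n)) \<longlonglongrightarrow> 0" using norm_completion_tendsto[OF X] by simp
    then show "cauchy_equiv X (\<lambda>n. 0)"
      using X tendsto_norm_zero_cancel[of X] unfolding cauchy_equiv_def
      by (simp add: Cauchy_const')
  next
    fix X :: "nat \<Rightarrow> 'a"
    assume "cauchy_equiv X (\<lambda>n. 0)"
    then have "(\<lambda>n. norm (X n)) \<longlonglongrightarrow> 0"
      unfolding cauchy_equiv_def using tendsto_norm_zero[of X] by simp
    then show "lim (\<lambda>n. norm (X n)) = 0" by (rule limI)
  qed
  show "norm (x + y) \<le> norm x + norm y"
  proof transfer
    fix X Y :: "nat \<Rightarrow> 'a"
    assume X: "cauchy_equiv X X" and Y: "cauchy_equiv Y Y"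
    then have XY: "cauchy_equiv (\<lambda>n. X n + Y n) (\<lambda>n. X n + Y n)"
      by (auto simp: cauchy_equiv_def Cauchy_add')
    show "lim (\<lambda>n. norm (X n + Y n)) \<le> lim (\<lambda>n. norm (X n)) + lim (\<lambda>n. norm (Y n))"
      by (rule LIMSEQ_le[OF norm_completion_tendsto[OF XY]
            tendsto_add[OF norm_completion_tendsto[OF X] norm_completion_tendsto[OF Y]]])
         (auto intro: norm_triangle_ineq)
  qed
  show "norm (a *\<^sub>R x) = \<bar>a\<bar> * norm x"
  proof transfer
    fix a :: real and X :: "nat \<Rightarrow> 'a"
    assume X: "cauchy_equiv X X"
    have "(\<lambda>n. norm (a *\<^sub>R X n)) \<longlonglongrightarrow> \<bar>a\<bar> * lim (\<lambda>n. norm (X n))"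
      using tendsto_mult_left[OF norm_completion_tendsto[OF X], of "\<bar>a\<bar>"] by simp
    then show "lim (\<lambda>n. norm (a *\<^sub>R X n)) = \<bar>a\<bar> * lim (\<lambda>n. norm (X n))" by (rule limI)
  qed
qed

end

lemma linear_embed_completion: "linear (embed_completion :: 'a::real_normed_vector \<Rightarrow> _)"
proof (rule linearI)
  fix x y :: 'a and a :: real
  show "embed_completion (x + y) = embed_completion x + embed_completion y"
    by transfer (simp add: cauchy_equiv_def Cauchy_const')
  show "embed_completion (a *\<^sub>R x) = a *\<^sub>R embed_completion x"
    by transfer (simp add: cauchy_equiv_def Cauchy_const')
qed

lemma norm_embed_completion: "norm (embed_completion x) = norm (x :: 'a::real_normed_vector)"
  by transfer simp

lemma embed_completion_tendsto:
  fixes X :: "nat \<Rightarrow> 'a::real_normed_vector"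
  assumes "Cauchy X"
  shows "(\<lambda>n. embed_completion (X n)) \<longlonglongrightarrow> abs_completion X"
proof (rule LIMSEQ_I)
  fix e :: real assume e: "e > 0"
  have X: "cauchy_equiv X X" using assms by (simp add: cauchy_equiv_def)
  obtain N where N: "\<And>m n. m \<ge> N \<Longrightarrow> n \<ge> N \<Longrightarrow> norm (X m - X n) < e / 2"
    using assms half_gt_zero[OF e] unfolding Cauchy_iff by meson
  have "norm (embed_completion (X n) - abs_completion X) < e" if n: "n \<ge> N" for n
  proof -
    have *: "cauchy_equiv (\<lambda>m. X n - X m) (\<lambda>m. X n - X m)"
      using assms by (simp add: cauchy_equiv_def Cauchy_diff' Cauchy_const')
    have "embed_completion (X n) - abs_completion X = abs_completion (\<lambda>m. X n - X m)"
      using X Cauchy_const'[of "X n"]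
      by (simp add: embed_completion.abs_eq minus_completion.abs_eq cauchy_equiv_def)
    then have "norm (embed_completion (X n) - abs_completion X) = lim (\<lambda>m. norm (X n - X m))"
      using norm_completion.abs_eq[OF *] by simp
    also have "\<dots> \<le> e / 2"
    proof (rule LIMSEQ_le_const2[OF norm_completion_tendsto[OF *]])
      show "\<exists>N. \<forall>m\<ge>N. norm (X n - X m) \<le> e / 2"
        using N n by (intro exI[of _ N]) (auto intro: less_imp_le)
    qed
    also have "\<dots> < e" using e by simp
    finally show ?thesis .
  qed
  then show "\<exists>N. \<forall>n\<ge>N. norm (embed_completion (X n) - abs_completion X) < e" by blast
qed

lemma closure_range_embed_completion: "closure (range (embed_completion :: 'a::real_normed_vector \<Rightarrow> _)) = UNIV"
proof -
  have "x \<in> closure (range embed_completion)" for x :: "'a completion"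
  proof -
    obtain X where "cauchy_equiv X X" "x = abs_completion X"
      using Quotient3_abs_rep[OF Quotient3_completion, of x]
        Quotient3_rep_reflp[OF Quotient3_completion, of x] by (metis (no_types))
    then have "(\<lambda>n. embed_completion (X n)) \<longlonglongrightarrow> x"
      using embed_completion_tendsto by (auto simp: cauchy_equiv_def)
    moreover have "\<forall>n. embed_completion (X n) \<in> range embed_completion" by simp
    ultimately show ?thesis unfolding closure_sequential by (intro exI[of _ "\<lambda>n. embed_completion (X n)"] conjI)
  qed
  then show ?thesis by blast
qed

instance completion :: (real_normed_vector) banach
proof
  fix Z :: "nat \<Rightarrow> 'a completion"
  assume Z: "Cauchy Z"
  have "\<exists>y. dist (embed_completion y) (Z n) < inverse (real (Suc n))" for n
    using closure_range_embed_completion closure_approachable[of "Z n" "range embed_completion"] by auto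
  then obtain Y where Y: "\<And>n. dist (embed_completion (Y n)) (Z n) < inverse (real (Suc n))" by metis
  have null: "(\<lambda>n. embed_completion (Y n) - Z n) \<longlonglongrightarrow> 0"
  proof (rule Lim_null_comparison[OF _ LIMSEQ_inverse_real_of_nat])
    show "\<forall>\<^sub>F n in sequentially. norm (embed_completion (Y n) - Z n) \<le> inverse (real (Suc n))"
      using less_imp_le[OF Y] by (simp only: dist_norm eventually_sequentially) blast
  qed
  have "Cauchy (\<lambda>n. (embed_completion (Y n) - Z n) + Z n)"
    by (rule Cauchy_add'[OF LIMSEQ_imp_Cauchy[OF null] Z])
  then have "Cauchy (\<lambda>n. embed_completion (Y n))" by simp
  then have "Cauchy Y"
    unfolding Cauchy_iff by (simp flip: linear_diff[OF linear_embed_completion] add: norm_embed_completion)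
  from tendsto_diff[OF embed_completion_tendsto[OF this] null]
  have "Z \<longlonglongrightarrow> abs_completion Y" by simp
  then show "convergent Z" by (rule convergentI)
qed


section \<open>The James-Hagler space\<close>

definition dyadic_tree :: "(nat \<times> nat) set" where
  "dyadic_tree = {(n, i). i < 2 ^ n}"

definition offspring :: "nat \<times> nat \<Rightarrow> nat \<times> nat \<Rightarrow> bool" where
  "offspring t s \<longleftrightarrow> s = (fst t + 1, 2 * snd t) \<or> s = (fst t + 1, 2 * snd t + 1)"

definition tree_level :: "nat \<Rightarrow> (nat \<times> nat) set" where
  "tree_level n = {(n, i) |i. i < 2 ^ n}"

text \<open>\<open>segment p q S\<close> says that \<open>S\<close> is a \<open>p\<close>-\<open>q\<close> segment; \<open>ts\<close> lists \<open>t\<^sub>1, \<dots>, t\<^sub>k\<close>.\<close>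

definition segment :: "nat \<Rightarrow> nat \<Rightarrow> (nat \<times> nat) set \<Rightarrow> bool" where
  "segment p q S \<longleftrightarrow> (\<exists>ts. ts \<noteq> [] \<and> S = set ts \<and> S \<subseteq> dyadic_tree \<and> successively offspring ts \<and>
     hd ts \<in> tree_level p \<and> last ts \<in> tree_level q)"

definition admissible :: "(nat \<times> nat) set set \<Rightarrow> bool" where
  "admissible F \<longleftrightarrow> finite F \<and> (\<exists>p q. p \<le> q \<and> (\<forall>S\<in>F. segment p q S)) \<and> pairwise disjnt F"

text \<open>
  Functions on the tree are extended by \<open>0\<close> to all of \<open>nat \<times> nat\<close>. The empty family is
  admissible here, but as it only contributes the value \<open>0\<close> it does not affect the maximum
  defining the norm.
\<close>

typedef jh_pre = "{x :: nat \<times> nat \<Rightarrow> real. finite {t. x t \<noteq> 0} \<and> (\<forall>t. t \<notin> dyadic_tree \<longrightarrow> x t = 0)}"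
  morphisms coord Abs_jh_pre
  by (rule exI[of _ "\<lambda>_. 0"]) simp

setup_lifting type_definition_jh_pre

definition family_value :: "(nat \<times> nat \<Rightarrow> real) \<Rightarrow> (nat \<times> nat) set set \<Rightarrow> real" where
  "family_value x F = (\<Sum>S\<in>F. \<bar>\<Sum>t\<in>S. x t\<bar>)"

definition jh_norm :: "(nat \<times> nat \<Rightarrow> real) \<Rightarrow> real" where
  "jh_norm x = Max {family_value x F |F. admissible F}"

lemma segment_finite: "segment p q S \<Longrightarrow> finite S"
  by (auto simp: segment_def)

text \<open>The maximum is over a finite set of values, so it is attained.\<close>

lemma finite_family_values:
  assumes "finite {t. x t \<noteq> 0}"
  shows "finite {family_value x F |F. admissible F}"
proof -
  define A where "A = {t. x t \<noteq> 0}"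
  have "family_value x F \<in> family_value x ` Pow (Pow A)" if F: "admissible F" for F
  proof -
    define G where "G = {S \<in> F. S \<inter> A \<noteq> {}}"
    have fin: "finite F" "\<And>S. S \<in> F \<Longrightarrow> finite S"
      using F segment_finite by (auto simp: admissible_def)
    have sum_eq: "(\<Sum>t\<in>S. x t) = (\<Sum>t\<in>S \<inter> A. x t)" if "S \<in> F" for S
      by (rule sum.mono_neutral_right) (use fin that in \<open>auto simp: A_def\<close>)
    have inj: "inj_on (\<lambda>S. S \<inter> A) G"
    proof (rule inj_onI)
      fix S S' assume *: "S \<in> G" "S' \<in> G" "S \<inter> A = S' \<inter> A"
      then have "\<not> disjnt S S'" by (auto simp: G_def disjnt_def)
      moreover have "S \<in> F" "S' \<in> F" using * by (simp_all add: G_def)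
      moreover have "pairwise disjnt F" using F by (simp add: admissible_def)
      ultimately show "S = S'" by (meson pairwiseD)
    qed
    have "family_value x F = (\<Sum>S\<in>F. \<bar>\<Sum>t\<in>S \<inter> A. x t\<bar>)"
      unfolding family_value_def by (rule sum.cong) (auto simp: sum_eq)
    also have "\<dots> = (\<Sum>S\<in>G. \<bar>\<Sum>t\<in>S \<inter> A. x t\<bar>)"
      by (rule sum.mono_neutral_right) (use fin in \<open>auto simp: G_def\<close>)
    also have "\<dots> = family_value x ((\<lambda>S. S \<inter> A) ` G)"
      unfolding family_value_def by (simp add: sum.reindex[OF inj])
    finally have "family_value x F = family_value x ((\<lambda>S. S \<inter> A) ` G)" .
    moreover have "(\<lambda>S. S \<inter> A) ` G \<in> Pow (Pow A)" by auto
    ultimately show ?thesis by (rule image_eqI)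
  qed
  then have "{family_value x F |F. admissible F} \<subseteq> family_value x ` Pow (Pow A)" by blast
  moreover have "finite (family_value x ` Pow (Pow A))" using assms by (simp add: A_def)
  ultimately show ?thesis by (rule finite_subset)
qed

lemma family_value_le_jh_norm:
  assumes "finite {t. x t \<noteq> 0}" "admissible F"
  shows "family_value x F \<le> jh_norm x"
  unfolding jh_norm_def using assms by (intro Max_ge finite_family_values) auto

lemma jh_norm_attained:
  assumes "finite {t. x t \<noteq> 0}"
  obtains F where "admissible F" "jh_norm x = family_value x F"
proof -
  have "admissible {}" by (auto simp: admissible_def)
  then have "{family_value x F |F. admissible F} \<noteq> {}" by blast
  from Max_in[OF finite_family_values[OF assms] this] that show ?thesis
    unfolding jh_norm_def by blast
qed

lemma admissible_singleton:
  assumes "t \<in> dyadic_tree"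
  shows "admissible {{t}}"
proof -
  have "segment (fst t) (fst t) {t}"
    unfolding segment_def
    by (rule exI[of _ "[t]"]) (use assms in \<open>auto simp: dyadic_tree_def tree_level_def\<close>)
  then show ?thesis unfolding admissible_def by auto
qed

instantiation jh_pre :: real_normed_vector
begin

lift_definition zero_jh_pre :: jh_pre is "\<lambda>t. 0" by simp

lift_definition plus_jh_pre :: "jh_pre \<Rightarrow> jh_pre \<Rightarrow> jh_pre" is "\<lambda>x y t. x t + y t"
proof -
  fix x y :: "nat \<times> nat \<Rightarrow> real"
  assume x: "finite {t. x t \<noteq> 0} \<and> (\<forall>t. t \<notin> dyadic_tree \<longrightarrow> x t = 0)"
    and y: "finite {t. y t \<noteq> 0} \<and> (\<forall>t. t \<notin> dyadic_tree \<longrightarrow> y t = 0)"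
  have "finite {t. x t + y t \<noteq> 0}"
    by (rule finite_subset[of _ "{t. x t \<noteq> 0} \<union> {t. y t \<noteq> 0}"]) (use x y in auto)
  with x y show "finite {t. x t + y t \<noteq> 0} \<and> (\<forall>t. t \<notin> dyadic_tree \<longrightarrow> x t + y t = 0)" by auto
qed

lift_definition minus_jh_pre :: "jh_pre \<Rightarrow> jh_pre \<Rightarrow> jh_pre" is "\<lambda>x y t. x t - y t"
proof -
  fix x y :: "nat \<times> nat \<Rightarrow> real"
  assume x: "finite {t. x t \<noteq> 0} \<and> (\<forall>t. t \<notin> dyadic_tree \<longrightarrow> x t = 0)"
    and y: "finite {t. y t \<noteq> 0} \<and> (\<forall>t. t \<notin> dyadic_tree \<longrightarrow> y t = 0)"
  have "finite {t. x t - y t \<noteq> 0}"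
    by (rule finite_subset[of _ "{t. x t \<noteq> 0} \<union> {t. y t \<noteq> 0}"]) (use x y in auto)
  with x y show "finite {t. x t - y t \<noteq> 0} \<and> (\<forall>t. t \<notin> dyadic_tree \<longrightarrow> x t - y t = 0)" by auto
qed

lift_definition uminus_jh_pre :: "jh_pre \<Rightarrow> jh_pre" is "\<lambda>x t. - x t" by simp

lift_definition scaleR_jh_pre :: "real \<Rightarrow> jh_pre \<Rightarrow> jh_pre" is "\<lambda>a x t. a * x t" by simp

lift_definition norm_jh_pre :: "jh_pre \<Rightarrow> real" is jh_norm .

definition dist_jh_pre :: "jh_pre \<Rightarrow> jh_pre \<Rightarrow> real" where
  "dist_jh_pre x y = norm (x - y)"

definition uniformity_jh_pre :: "(jh_pre \<times> jh_pre) filter" where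
  "uniformity_jh_pre = (INF e\<in>{0 <..}. principal {(x, y). dist x y < e})"

definition open_jh_pre :: "jh_pre set \<Rightarrow> bool" where
  "open_jh_pre U \<longleftrightarrow> (\<forall>x\<in>U. \<forall>\<^sub>F (x', y) in uniformity. x' = x \<longrightarrow> y \<in> U)"

definition sgn_jh_pre :: "jh_pre \<Rightarrow> jh_pre" where
  "sgn_jh_pre x = scaleR (inverse (norm x)) x"

instance
proof
  fix x y z :: jh_pre and a b :: real
  show "x + y + z = x + (y + z)" by transfer (simp add: add.assoc)
  show "x + y = y + x" by transfer (simp add: add.commute)
  show "0 + x = x" by transfer simp
  show "- x + x = 0" by transfer simp
  show "x - y = x + - y" by transfer simp
  show "a *\<^sub>R (x + y) = a *\<^sub>R x + a *\<^sub>R y" by transfer (simp add: distrib_left)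
  show "(a + b) *\<^sub>R x = a *\<^sub>R x + b *\<^sub>R x" by transfer (simp add: distrib_right)
  show "a *\<^sub>R b *\<^sub>R x = (a * b) *\<^sub>R x" by transfer (simp add: mult.assoc)
  show "1 *\<^sub>R x = x" by transfer simp
  show "dist x y = norm (x - y)" by (rule dist_jh_pre_def)
  show "sgn x = scaleR (inverse (norm x)) x" by (rule sgn_jh_pre_def)
  show "uniformity = (INF e\<in>{0 <..}. principal {(x :: jh_pre, y). dist x y < e})"
    by (rule uniformity_jh_pre_def)
  show "open U \<longleftrightarrow> (\<forall>x\<in>U. \<forall>\<^sub>F (x', y) in uniformity. x' = x \<longrightarrow> y \<in> U)" for U :: "jh_pre set"
    by (rule open_jh_pre_def)
  show "norm x = 0 \<longleftrightarrow> x = 0"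
  proof (transfer, rule iffI)
    fix x :: "nat \<times> nat \<Rightarrow> real"
    assume x: "finite {t. x t \<noteq> 0} \<and> (\<forall>t. t \<notin> dyadic_tree \<longrightarrow> x t = 0)" and n: "jh_norm x = 0"
    have "x t = 0" if "t \<in> dyadic_tree" for t
      using family_value_le_jh_norm[OF conjunct1[OF x] admissible_singleton[OF that]] n
      by (simp add: family_value_def)
    with x show "x = (\<lambda>t. 0)" by blast
  next
    fix x :: "nat \<times> nat \<Rightarrow> real"
    assume x: "finite {t. x t \<noteq> 0} \<and> (\<forall>t. t \<notin> dyadic_tree \<longrightarrow> x t = 0)" and "x = (\<lambda>t. 0)"
    moreover obtain F where "jh_norm x = family_value x F"
      using jh_norm_attained[OF conjunct1[OF x]] .
    ultimately show "jh_norm x = 0" by (simp add: family_value_def)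
  qed
  show "norm (x + y) \<le> norm x + norm y"
  proof transfer
    fix x y :: "nat \<times> nat \<Rightarrow> real"
    assume x: "finite {t. x t \<noteq> 0} \<and> (\<forall>t. t \<notin> dyadic_tree \<longrightarrow> x t = 0)"
      and y: "finite {t. y t \<noteq> 0} \<and> (\<forall>t. t \<notin> dyadic_tree \<longrightarrow> y t = 0)"
    have fin: "finite {t. x t + y t \<noteq> 0}"
      by (rule finite_subset[of _ "{t. x t \<noteq> 0} \<union> {t. y t \<noteq> 0}"]) (use x y in auto)
    obtain F where F: "admissible F" "jh_norm (\<lambda>t. x t + y t) = family_value (\<lambda>t. x t + y t) F"
      using jh_norm_attained[OF fin] .
    have "family_value (\<lambda>t. x t + y t) F \<le> family_value x F + family_value y F"
      unfolding family_value_def sum.distrib[symmetric]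
      by (rule sum_mono) (simp add: sum.distrib abs_triangle_ineq)
    with F family_value_le_jh_norm[of x F] family_value_le_jh_norm[of y F] x y
    show "jh_norm (\<lambda>t. x t + y t) \<le> jh_norm x + jh_norm y" by linarith
  qed
  show "norm (a *\<^sub>R x) = \<bar>a\<bar> * norm x"
  proof transfer
    fix a :: real and x :: "nat \<times> nat \<Rightarrow> real"
    assume x: "finite {t. x t \<noteq> 0} \<and> (\<forall>t. t \<notin> dyadic_tree \<longrightarrow> x t = 0)"
    have fin: "finite {t. a * x t \<noteq> 0}"
      by (rule finite_subset[of _ "{t. x t \<noteq> 0}"]) (use x in auto)
    have val: "family_value (\<lambda>t. a * x t) F = \<bar>a\<bar> * family_value x F" for F
      unfolding family_value_def by (simp add: abs_mult flip: sum_distrib_left)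
    obtain F where F: "admissible F" "jh_norm (\<lambda>t. a * x t) = family_value (\<lambda>t. a * x t) F"
      using jh_norm_attained[OF fin] .
    obtain G where G: "admissible G" "jh_norm x = family_value x G"
      using jh_norm_attained[OF conjunct1[OF x]] .
    have "jh_norm (\<lambda>t. a * x t) \<le> \<bar>a\<bar> * jh_norm x"
      using F family_value_le_jh_norm[OF conjunct1[OF x] F(1)] by (simp add: val mult_left_mono)
    moreover have "\<bar>a\<bar> * jh_norm x \<le> jh_norm (\<lambda>t. a * x t)"
      using family_value_le_jh_norm[OF fin G(1)] G(2) by (simp add: val)
    ultimately show "jh_norm (\<lambda>t. a * x t) = \<bar>a\<bar> * jh_norm x" by simp
  qed
qed

end

type_synonym JH = "jh_pre completion"


section \<open>Weak-star slices\<close>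

definition wstar_slice ::
  "('a::real_normed_vector \<Rightarrow>\<^sub>L real) set \<Rightarrow> 'a \<Rightarrow> real \<Rightarrow> ('a \<Rightarrow>\<^sub>L real) set" where
  "wstar_slice B x \<alpha> =
     {f \<in> B. blinfun_apply f x > (SUP g\<in>B. blinfun_apply g x) - \<alpha>}"

end

theory Submission
  imports Defs
begin

text \<open>
  Take \<open>x = e\<^sub>r - (e\<^sub>a + e\<^sub>b) / 4\<close>, where \<open>r\<close> is the root of the tree and \<open>a\<close>, \<open>b\<close> are its
  offspring. Every admissible family other than \<open>{{r}}\<close> has value at most \<open>3/4\<close> on \<open>x\<close>, so the
  norm is affine near \<open>x\<close>: \<open>\<parallel>x + h\<parallel> = 1 + h r\<close> for \<open>\<parallel>h\<parallel> \<le> 1/8\<close>. Hence two functionals \<open>f\<close>, \<open>g\<close> in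
  the slice of width \<open>\<alpha>\<close> satisfy
  \<open>(f - g) h = f (x + h) + g (x - h) - f x - g x \<le> \<parallel>x + h\<parallel> + \<parallel>x - h\<parallel> - 2 + 2\<alpha> = 2\<alpha>\<close>
  whenever \<open>\<parallel>h\<parallel> \<le> 1/8\<close>, that is, \<open>\<parallel>f - g\<parallel> \<le> 16\<alpha>\<close>.
\<close>

section \<open>Extension of bounded operators to the completion\<close>

lemma blinfun_lim_Cauchy:
  fixes f :: "'a::real_normed_vector \<Rightarrow>\<^sub>L 'b::banach"
  assumes "cauchy_equiv X X"
  shows "(\<lambda>n. f (X n)) \<longlonglongrightarrow> lim (\<lambda>n. f (X n))"
proof -
  have "Cauchy (\<lambda>n. f (X n))"
    using assms by (intro bounded_linear.Cauchy[OF blinfun.bounded_linear_right])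
      (simp add: cauchy_equiv_def)
  then show ?thesis
    by (simp add: Cauchy_convergent_iff convergent_LIMSEQ_iff)
qed

text \<open>Extension by continuity: completeness of the codomain makes \<open>lim\<close> an actual
  limit. The obligation is independence of the representative, which holds because
  \<open>f (X n) - f (Y n) = f (X n - Y n)\<close> tends to \<open>f 0\<close>.\<close>

lift_definition extend_completion ::
  "('a::real_normed_vector \<Rightarrow>\<^sub>L 'b::banach) \<Rightarrow> 'a completion \<Rightarrow> 'b"
  is "\<lambda>f X. lim (\<lambda>n. blinfun_apply f (X n))"
proof -
  fix f :: "'a \<Rightarrow>\<^sub>L 'b" and X Y :: "nat \<Rightarrow> 'a"
  assume *: "cauchy_equiv X Y"
  have a: "(\<lambda>n. f (Y n)) \<longlonglongrightarrow> lim (\<lambda>n. f (Y n))"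
    using * by (intro blinfun_lim_Cauchy) (auto simp: cauchy_equiv_def)
  have "(\<lambda>n. f (X n - Y n)) \<longlonglongrightarrow> f 0"
    using * unfolding cauchy_equiv_def by (intro blinfun.tendsto tendsto_const) auto
  from tendsto_add[OF this a] have "(\<lambda>n. f (X n)) \<longlonglongrightarrow> lim (\<lambda>n. f (Y n))"
    by (simp add: blinfun.diff_right)
  then show "lim (\<lambda>n. f (X n)) = lim (\<lambda>n. f (Y n))"
    by (rule limI)
qed

lemma extend_completion_embed:
  fixes f :: "'a::real_normed_vector \<Rightarrow>\<^sub>L 'b::banach"
  shows "extend_completion f (embed_completion x) = f x"
  by transfer simp

lemma extend_completion_add:
  fixes f :: "'a::real_normed_vector \<Rightarrow>\<^sub>L 'b::banach"
  shows "extend_completion f (x + y) = extend_completion f x + extend_completion f y"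
proof transfer
  fix f :: "'a \<Rightarrow>\<^sub>L 'b" and X Y :: "nat \<Rightarrow> 'a"
  assume "cauchy_equiv X X" "cauchy_equiv Y Y"
  from tendsto_add[OF this[THEN blinfun_lim_Cauchy[of _ f]]]
  show "lim (\<lambda>n. f (X n + Y n)) = lim (\<lambda>n. f (X n)) + lim (\<lambda>n. f (Y n))"
    by (intro limI) (simp add: blinfun.add_right)
qed

lemma extend_completion_scaleR:
  fixes f :: "'a::real_normed_vector \<Rightarrow>\<^sub>L 'b::banach"
  shows "extend_completion f (a *\<^sub>R x) = a *\<^sub>R extend_completion f x"
proof transfer
  fix f :: "'a \<Rightarrow>\<^sub>L 'b" and a and X :: "nat \<Rightarrow> 'a"
  assume "cauchy_equiv X X"
  from tendsto_scaleR[OF tendsto_const blinfun_lim_Cauchy[OF this, of f], of a]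
  show "lim (\<lambda>n. f (a *\<^sub>R X n)) = a *\<^sub>R lim (\<lambda>n. f (X n))"
    by (intro limI) (simp add: blinfun.scaleR_right)
qed

lemma norm_extend_completion_le:
  fixes f :: "'a::real_normed_vector \<Rightarrow>\<^sub>L 'b::banach"
  shows "norm (extend_completion f x) \<le> norm f * norm x"
proof (transfer fixing: f)
  fix X :: "nat \<Rightarrow> 'a"
  assume X: "cauchy_equiv X X"
  show "norm (lim (\<lambda>n. f (X n))) \<le> norm f * lim (\<lambda>n. norm (X n))"
    by (rule LIMSEQ_le[OF tendsto_norm[OF blinfun_lim_Cauchy[OF X]]
          tendsto_mult_left[OF norm_completion_tendsto[OF X]]]) (auto intro: norm_blinfun)
qed

lemma bounded_linear_extend_completion:
  fixes f :: "'a::real_normed_vector \<Rightarrow>\<^sub>L 'b::banach"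
  shows "bounded_linear (extend_completion f)"
  by (rule bounded_linear_intro[where K = "norm f"])
     (use norm_extend_completion_le in \<open>auto simp: extend_completion_add extend_completion_scaleR mult.commute\<close>)

section \<open>Transfer of properties from the dense image of the embedding\<close>

lemma completion_closed_induct:
  fixes y :: "'a::real_normed_vector completion"
  assumes "closed {y. P y}" and "\<And>x. P (embed_completion x)"
  shows "P y"
proof -
  have "closure (range embed_completion) \<subseteq> {y. P y}"
    using assms by (intro closure_minimal) auto
  then show ?thesis by (auto simp: closure_range_embed_completion)
qed

text \<open>For inequalities known only on an open ball: with \<open>Q\<close> open and
  \<open>P\<close> closed, the implication from \<open>Q\<close> to \<open>P\<close> is itself a
  closed condition, so density applies to it.\<close>

lemma completion_open_closed_induct:
  fixes y :: "'a::real_normed_vector completion"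
  assumes "open {y. Q y}" "closed {y. P y}" and "\<And>x. Q (embed_completion x) \<Longrightarrow> P (embed_completion x)"
    and "Q y"
  shows "P y"
proof -
  have "closed {y. Q y \<longrightarrow> P y}"
  proof -
    have "{y. Q y \<longrightarrow> P y} = - {y. Q y} \<union> {y. P y}" by auto
    then show ?thesis using assms(1,2) by auto
  qed
  then show ?thesis
    using completion_closed_induct[of "\<lambda>y. Q y \<longrightarrow> P y"] assms(3,4) by blast
qed

section \<open>Slices at a point where the norm is locally affine\<close>

lemma diameter_wstar_slice_le:
  fixes x :: "'a::real_normed_vector"
  assumes "r > 0" "\<alpha> > 0"
    and flat: "\<And>h. norm h < r \<Longrightarrow> norm (x + h) + norm (x - h) \<le> 2"
    and f0: "f0 \<in> cball (0 :: 'a \<Rightarrow>\<^sub>L real) 1" "blinfun_apply f0 x = 1"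
  shows "diameter (wstar_slice (cball (0 :: 'a \<Rightarrow>\<^sub>L real) 1) x \<alpha>) \<le> 4 * \<alpha> / r"
proof (rule diameter_le)
  show "wstar_slice (cball (0 :: 'a \<Rightarrow>\<^sub>L real) 1) x \<alpha> \<noteq> {} \<or> 0 \<le> 4 * \<alpha> / r"
    using assms by simp
  have le: "blinfun_apply f y \<le> norm y" if "f \<in> cball 0 1" for f :: "'a \<Rightarrow>\<^sub>L real" and y
  proof -
    have "\<bar>blinfun_apply f y\<bar> \<le> norm f * norm y"
      using norm_blinfun[of f y] by simp
    also have "\<dots> \<le> norm y"
      using that by (simp add: mult_left_le_one_le)
    finally show ?thesis by simp
  qed
  \<comment> \<open>Only a lower bound on the supremum is wanted: \<open>f0\<close> supplies it, and
    \<open>norm x\<close> bounds the set above, as \<open>cSUP_upper2\<close> requires.\<close>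
  have "1 \<le> (SUP g\<in>cball (0 :: 'a \<Rightarrow>\<^sub>L real) 1. blinfun_apply g x)"
    using le f0 by (intro cSUP_upper2[of _ _ f0] bdd_aboveI2[where M = "norm x"]) auto
  then have slice: "f \<in> cball 0 1 \<and> blinfun_apply f x > 1 - \<alpha>"
    if "f \<in> wstar_slice (cball (0 :: 'a \<Rightarrow>\<^sub>L real) 1) x \<alpha>" for f
    using that by (auto simp: wstar_slice_def)
  fix f g assume "f \<in> wstar_slice (cball (0 :: 'a \<Rightarrow>\<^sub>L real) 1) x \<alpha>"
    and "g \<in> wstar_slice (cball (0 :: 'a \<Rightarrow>\<^sub>L real) 1) x \<alpha>"
  with slice have fg: "f \<in> cball 0 1" "g \<in> cball 0 1"
    "blinfun_apply f x > 1 - \<alpha>" "blinfun_apply g x > 1 - \<alpha>"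
    by auto
  have up: "blinfun_apply (f - g) h \<le> 2 * \<alpha>" if "norm h < r" for h
    using le[OF fg(1), of "x + h"] le[OF fg(2), of "x - h"] flat[OF that] fg(3,4)
    by (simp add: blinfun.add_right blinfun.diff_right blinfun.diff_left)
  have up_abs: "\<bar>blinfun_apply (f - g) h\<bar> \<le> 2 * \<alpha>" if "norm h < r" for h
    using up[of h] up[of "- h"] that by (simp add: blinfun.minus_right)
  have "norm (f - g) \<le> 4 * \<alpha> / r"
  proof (rule norm_blinfun_bound)
    fix z :: 'a
    show "norm (blinfun_apply (f - g) z) \<le> 4 * \<alpha> / r * norm z"
    proof (cases "z = 0")
      case False
      \<comment> \<open>\<open>flat\<close> speaks of the open ball of radius \<open>r\<close>, so
        \<open>z\<close> is scaled to norm \<open>r / 2\<close>; hence the bound is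
        \<open>4 * \<alpha> / r\<close> and not \<open>2 * \<alpha> / r\<close>.\<close>
      have "norm ((r / (2 * norm z)) *\<^sub>R z) < r" using False \<open>r > 0\<close> by simp
      from up_abs[OF this] have "r / (2 * norm z) * \<bar>blinfun_apply (f - g) z\<bar> \<le> 2 * \<alpha>"
        using \<open>r > 0\<close> by (simp add: blinfun.scaleR_right abs_mult)
      then show ?thesis using False \<open>r > 0\<close> by (simp add: field_simps)
    qed simp
  qed (use assms in simp)
  then show "norm (f - g) \<le> 4 * \<alpha> / r" .
qed

lemma INF_diameter_wstar_slice_eq_0:
  fixes x :: "'a::real_normed_vector"
  assumes "r > 0"
    and flat: "\<And>h. norm h < r \<Longrightarrow> norm (x + h) + norm (x - h) \<le> 2"
    and f0: "f0 \<in> cball (0 :: 'a \<Rightarrow>\<^sub>L real) 1" "blinfun_apply f0 x = 1"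
  shows "(INF \<alpha>\<in>{0<..}. diameter (wstar_slice (cball (0 :: 'a \<Rightarrow>\<^sub>L real) 1) x \<alpha>)) = 0"
    (is "(INF \<alpha>\<in>_. ?d \<alpha>) = 0")
proof (rule antisym)
  have pos: "0 \<le> ?d \<alpha>" for \<alpha>
    by (rule diameter_ge_0, rule bounded_subset[OF bounded_cball[of 0 1]])
       (auto simp: wstar_slice_def)
  then show "0 \<le> (INF \<alpha>\<in>{0<..}. ?d \<alpha>)"
    by (intro cINF_greatest) auto
  show "(INF \<alpha>\<in>{0<..}. ?d \<alpha>) \<le> 0"
  proof (rule field_le_epsilon)
    \<comment> \<open>The diameter bound \<open>4 * \<alpha> / r\<close> equals \<open>e\<close> at
      \<open>\<alpha> = r * e / 4\<close>.\<close>
    fix e :: real assume "e > 0"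
    with \<open>r > 0\<close> have "r * e / 4 > 0" by simp
    from diameter_wstar_slice_le[OF \<open>r > 0\<close> this flat f0] have "?d (r * e / 4) \<le> e"
      using \<open>r > 0\<close> by simp
    moreover have "bdd_below (?d ` {0<..})"
      by (rule bdd_belowI2[OF pos])
    then have "(INF \<alpha>\<in>{0<..}. ?d \<alpha>) \<le> ?d (r * e / 4)"
      by (rule cINF_lower) (use \<open>r * e / 4 > 0\<close> in simp)
    ultimately show "(INF \<alpha>\<in>{0<..}. ?d \<alpha>) \<le> 0 + e" by linarith
  qed
qed

section \<open>Segments and families through the root\<close>

lemma successively_offspring_level:
  "successively offspring (t # ts) \<Longrightarrow> s \<in> set ts \<Longrightarrow> fst t < fst s"
proof (induction ts arbitrary: t)
  case (Cons u ts)
  have "fst u = fst t + 1" using Cons.prems(1) by (auto simp: offspring_def)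
  moreover have "s = u \<or> fst u < fst s" using Cons.IH[of u] Cons.prems by auto
  ultimately show ?case by auto
qed simp

lemma tree_level_0: "tree_level 0 = {(0, 0)}"
  by (auto simp: tree_level_def)

lemma segment_Cons:
  assumes "segment p q S"
  obtains t ts where "S = set (t # ts)" "successively offspring (t # ts)" "t \<in> tree_level p"
proof -
  obtain us where us: "us \<noteq> []" "S = set us" "successively offspring us" "hd us \<in> tree_level p"
    using assms unfolding segment_def by blast
  then show thesis by (intro that[of "hd us" "tl us"]) simp_all
qed

text \<open>Levels strictly increase along the listing, so the root can only be its head.\<close>

lemma segment_root:
  assumes "segment p q S" "(0, 0) \<in> S"
  shows "p = 0"
proof -
  obtain t ts where ts: "S = set (t # ts)" "successively offspring (t # ts)" "t \<in> tree_level p"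
    using assms(1) by (rule segment_Cons)
  then have "(0, 0) = t"
    using assms(2) successively_offspring_level[OF ts(2), of "(0, 0)"] by auto
  with ts(3) show ?thesis by (auto simp: tree_level_def)
qed

text \<open>All members start in a common level. If one contains the root, this is level 0, whose
  only element is the root, so all members share it and disjointness leaves a single one.\<close>

lemma admissible_root:
  assumes "admissible F" "S \<in> F" "(0, 0) \<in> S"
  shows "F = {S}"
proof -
  obtain p q where pq: "\<And>S. S \<in> F \<Longrightarrow> segment p q S" and disj: "pairwise disjnt F"
    using assms(1) by (auto simp: admissible_def)
  have "p = 0" using segment_root pq assms(2,3) by blast
  have "(0, 0) \<in> S'" if "S' \<in> F" for S'
    using pq[OF that] \<open>p = 0\<close> by (elim segment_Cons) (auto simp: tree_level_0)
  then have "S' = S" if "S' \<in> F" for S'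
    using that disj assms(2,3) by (metis disjnt_iff pairwiseD)
  with assms(2) show ?thesis by blast
qed

section \<open>The smooth point and the norm near it\<close>

text \<open>The weights at level 1 are negative so that prolonging \<open>{(0, 0)}\<close> lowers
  its value, whichever offspring is taken.\<close>

lift_definition smooth_point :: jh_pre is
  "(\<lambda>t. 0)((0, 0) := 1, (1, 0) := - 1 / 4, (1, 1) := - 1 / 4)"
proof
  show "finite {t. ((\<lambda>t. 0)((0, 0) := 1, (1, 0) := - 1 / 4, (1, 1) := - 1 / 4 :: real)) t \<noteq> 0}"
    by (rule finite_subset[of _ "{(0, 0), (1, 0), (1, 1)}"]) auto
qed (auto simp: dyadic_tree_def)

text \<open>A single segment that continues past the root meets exactly one of its offspring and has
  value \<open>1 - 1/4\<close>. A family avoiding the root sees at most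
  \<open>1/4 + 1/4\<close>.\<close>

lemma family_value_smooth_point_le:
  assumes F: "admissible F" "F \<noteq> {{(0, 0)}}"
  shows "family_value (coord smooth_point) F \<le> 3 / 4"
proof (cases "\<exists>S\<in>F. (0, 0) \<in> S")
  case True
  let ?x = "coord smooth_point"
  obtain S where S: "S \<in> F" "(0, 0) \<in> S" using True by blast
  then have FS: "F = {S}" using F(1) admissible_root by blast
  obtain p q where pq: "segment p q S" using F(1) S(1) by (auto simp: admissible_def)
  then have "p = 0" using S(2) by (rule segment_root)
  with pq obtain ts where ts: "S = set ((0, 0) # ts)" "successively offspring ((0, 0) # ts)"
    by (auto elim!: segment_Cons simp: tree_level_0)
  with F(2) FS obtain t ts' where ts': "ts = t # ts'" by (cases ts) auto
  with ts(2) have t: "t = (1, 0) \<or> t = (1, 1)" by (auto simp: offspring_def)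
  \<comment> \<open>Past \<open>t\<close> the segment lies below level 1, hence off the support of
    \<open>smooth_point\<close>.\<close>
  have "1 < fst s" if "s \<in> set ts'" for s
    using successively_offspring_level[of t ts' s] ts(2) ts' t that by auto
  then have far: "(1, 0) \<notin> set ts'" "(1, 1) \<notin> set ts'"
    by fastforce+
  have "(\<Sum>s\<in>S. ?x s) = (\<Sum>s\<in>{(0, 0), t}. ?x s)"
    by (rule sum.mono_neutral_right)
       (use ts(1) ts' far in \<open>auto simp: smooth_point.rep_eq split: if_splits\<close>)
  also have "\<dots> = 3 / 4" using t by (auto simp: smooth_point.rep_eq)
  finally show ?thesis by (simp add: family_value_def FS)
next
  case False
  let ?x = "coord smooth_point"
  have fin: "finite F" "\<And>S. S \<in> F \<Longrightarrow> finite S" and disj: "pairwise disjnt F"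
    using F(1) segment_finite by (auto simp: admissible_def)
  have "family_value ?x F \<le> (\<Sum>S\<in>F. \<Sum>t\<in>S. \<bar>?x t\<bar>)"
    unfolding family_value_def by (intro sum_mono sum_abs)
  also have "\<dots> = (\<Sum>t\<in>\<Union>F. \<bar>?x t\<bar>)"
    using fin disj by (subst sum.Union_disjoint) (auto simp: pairwise_def disjnt_def)
  \<comment> \<open>Adding both offspring to the union makes the index set independent of
    \<open>F\<close> once the points off the support are dropped; what remains is 1/2.\<close>
  also have "\<dots> \<le> (\<Sum>t\<in>\<Union>F \<union> {(1, 0), (1, 1)}. \<bar>?x t\<bar>)"
    using fin by (intro sum_mono2) auto
  also have "\<dots> = (\<Sum>t\<in>{(1, 0), (1, 1)}. \<bar>?x t\<bar>)"
    using fin False by (intro sum.mono_neutral_right) (auto simp: smooth_point.rep_eq)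
  also have "\<dots> \<le> 3 / 4" by (simp add: smooth_point.rep_eq)
  finally show ?thesis .
qed

lemma finite_coord: "finite {t. coord x t \<noteq> 0}"
  using coord[of x] by simp

lemma family_value_le_norm: "admissible F \<Longrightarrow> family_value (coord x) F \<le> norm x"
  by (simp add: norm_jh_pre.rep_eq family_value_le_jh_norm finite_coord)

lemma abs_coord_root_le: "\<bar>coord h (0, 0)\<bar> \<le> norm h"
  using family_value_le_norm[OF admissible_singleton[of "(0, 0)"], of h]
  by (simp add: family_value_def dyadic_tree_def)

lemma family_value_add_le:
  "family_value (coord (x + y)) F \<le> family_value (coord x) F + family_value (coord y) F"
  unfolding family_value_def sum.distrib[symmetric]
  by (rule sum_mono) (simp add: plus_jh_pre.rep_eq sum.distrib abs_triangle_ineq)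

text \<open>The radius 1/8 is half the gap between 1 and 3/4. A family other than
  \<open>{{(0, 0)}}\<close> gives at most \<open>3/4 + 1/8 = 1 - 1/8\<close>, which is at most
  \<open>1 + coord h (0, 0)\<close>; the family \<open>{{(0, 0)}}\<close> gives exactly
  \<open>1 + coord h (0, 0)\<close>, as this number is positive.\<close>

lemma norm_smooth_point_add_le:
  assumes "norm h \<le> 1 / 8"
  shows "norm (smooth_point + h) \<le> 1 + coord h (0, 0)"
proof -
  obtain F where F: "admissible F" "norm (smooth_point + h) = family_value (coord (smooth_point + h)) F"
    using jh_norm_attained[OF finite_coord] by (metis norm_jh_pre.rep_eq)
  show ?thesis
  proof (cases "F = {{(0, 0)}}")
    case True
    then show ?thesis
      using F(2) abs_coord_root_le[of h] assms
      by (simp add: family_value_def plus_jh_pre.rep_eq smooth_point.rep_eq)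
  next
    case False
    then show ?thesis
      using F family_value_smooth_point_le[OF F(1)] family_value_add_le[of smooth_point h F]
        family_value_le_norm[OF F(1), of h] abs_coord_root_le[of h] assms
      by linarith
  qed
qed

lemma norm_smooth_point: "norm smooth_point = 1"
  using norm_smooth_point_add_le[of 0] abs_coord_root_le[of smooth_point]
  by (simp add: zero_jh_pre.rep_eq smooth_point.rep_eq)

theorem theorem3p3:
  shows "\<exists>x :: JH. norm x = 1 \<and>
    (INF \<alpha>\<in>{0<..}. diameter (wstar_slice (cball (0 :: JH \<Rightarrow>\<^sub>L real) 1) x \<alpha>)) = 0"
proof (intro exI[of _ "embed_completion smooth_point"] conjI)
  let ?x = "embed_completion smooth_point"
  show "norm ?x = 1" by (simp add: norm_embed_completion norm_smooth_point)
  have root: "bounded_linear (\<lambda>h. coord h (0, 0))"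
    by (rule bounded_linear_intro[where K = 1])
       (auto simp: plus_jh_pre.rep_eq scaleR_jh_pre.rep_eq abs_coord_root_le)
  \<comment> \<open>The norming functional is the root coordinate, extended from
    \<open>jh_pre\<close> to \<open>JH\<close>. Its norm is at most 1 because
    \<open>{{(0, 0)}}\<close> is admissible.\<close>
  define f0 where "f0 = Blinfun (extend_completion (Blinfun (\<lambda>h. coord h (0, 0))))"
  have f0_apply: "blinfun_apply f0 = extend_completion (Blinfun (\<lambda>h. coord h (0, 0)))"
    by (simp add: f0_def bounded_linear_Blinfun_apply bounded_linear_extend_completion)
  have "norm (Blinfun (\<lambda>h. coord h (0, 0))) \<le> 1"
    by (rule norm_blinfun_bound)
       (simp_all add: bounded_linear_Blinfun_apply[OF root] abs_coord_root_le)
  then have "norm (extend_completion (Blinfun (\<lambda>h. coord h (0, 0))) y) \<le> 1 * norm y" for y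
    by (rule order.trans[OF norm_extend_completion_le mult_right_mono]) simp
  then have "norm f0 \<le> 1"
    by (intro norm_blinfun_bound) (simp_all add: f0_apply)
  then have f0: "f0 \<in> cball 0 1" by simp
  have f0_x: "blinfun_apply f0 ?x = 1"
    by (simp add: f0_apply extend_completion_embed bounded_linear_Blinfun_apply[OF root]
        smooth_point.rep_eq)
  have flat: "norm (?x + h) + norm (?x - h) \<le> 2" if "norm h < 1 / 8" for h
  proof (rule completion_open_closed_induct[where Q = "\<lambda>h. norm h < 1 / 8"
        and P = "\<lambda>h. norm (?x + h) + norm (?x - h) \<le> 2"])
    show "open {h :: JH. norm h < 1 / 8}"
      by (intro open_Collect_less continuous_intros)
    show "closed {h. norm (?x + h) + norm (?x - h) \<le> 2}"
      by (intro closed_Collect_le continuous_intros)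
  next
    fix h :: jh_pre
    assume "norm (embed_completion h) < 1 / 8"
    then have "norm h \<le> 1 / 8" by (simp add: norm_embed_completion)
    \<comment> \<open>In the sum of the bounds for \<open>h\<close> and \<open>- h\<close> the root
      coordinates cancel.\<close>
    then show "norm (?x + embed_completion h) + norm (?x - embed_completion h) \<le> 2"
      using norm_smooth_point_add_le[of h] norm_smooth_point_add_le[of "- h"]
      by (simp add: norm_embed_completion uminus_jh_pre.rep_eq
          flip: linear_add[OF linear_embed_completion] linear_diff[OF linear_embed_completion])
  qed (rule that)
  show "(INF \<alpha>\<in>{0<..}. diameter (wstar_slice (cball (0 :: JH \<Rightarrow>\<^sub>L real) 1) ?x \<alpha>)) = 0"
    by (rule INF_diameter_wstar_slice_eq_0[where r = "1 / 8", OF _ flat f0 f0_x]) auto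
qed

end
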